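(* Let $r \geq 2$ be an integer. For every $r$-graph $G$, \[\alpha(G) \leq |V(G)| - \sum_{H \in \mathcal{C}(G)} \left\lceil \frac{|V(H)|-1}{\Delta(H)(r-1)} \right\rceil,\] and equality holds if for each $H \in \mathcal{C}(G)$, $H$ is a copy of $U_{|V(H)|,r,\Delta(H)}$.
   Context: All sets are finite unless evidently infinite; $\mathbb{N}=\{1,2,\dots\}$; for integers $1\le m \leq n$, $[m,n] = \{i \in \mathbb{N} : m \leq i \leq n\}$ and $[n]=[1,n]$; $[0]=\emptyset$. For a set $X$, $\binom{X}{r}$ is the set of all $r$-element subsets of $X$. An $r$-graph $G$ is a pair $(V(G),E(G))$ where $V(G)$ is a set (of vertices) and $E(G) \subseteq \binom{V(G)}{r}$ (the edges). A set $I \subseteq V(G)$ is independent if no edge of $G$ is a subset of $I$; $\alpha(G)$ is the size of a largest independent set of $G$. The degree $d_G(v)$ of a vertex $v$ is the number of edges containing $v$; $\Delta(G) = \max\{d_G(v) : v \in V(G)\}$. A $vw$-path of $G$ is a sequence $e_1,\dots,e_p$ of edges ($p \geq 1$) with $v \in e_1$, $w \in e_p$, and $e_i \cap e_{i+1} \neq \emptyset$ for each $i \in [p-1]$. $G$ is connected if it has a $vw$-path for every two distinct vertices $v,w$. An $r$-graph $H$ is a subgraph of $G$ if $V(H)\subseteq V(G)$ and $E(H)\subseteq E(G)$. A component of $G$ is a maximal connected subgraph of $G$ (a connected subgraph that is not a subgraph of another connected subgraph). A singleton is an $r$-graph consisting of only one vertex; $\mathcal{C}(G)$ denotes the set of non-singleton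 components of $G$, i.e. those with at least two vertices. "Copy" means isomorphic copy. For $r \geq 2$ and $k \geq 1$, $f(r,k)$ is the smallest integer $n$ such that there exists an $r$-graph $G$ with $\Delta(G)=k$ and $|V(G)|=n$. The $r$-graphs $U_{n,r,k}$: $U_{r,r,1} = ([r],\{[r]\})$ (a connected $r$-graph with at least two vertices and maximum degree $1$ has exactly $r$ vertices). For $r \geq 2$, $k \geq 2$, $n \geq f(r,k)$, define $U_{n,r,k}$ as follows. Let $p = \left\lceil \frac{n-1}{k(r-1)} \right\rceil$, so $p \geq 1$ and $n-1 = (p-1)k(r-1)+q$ for some integer $q$ with $1 \leq q \leq k(r-1)$. Let $n' = n-p$, so $n' = (p-1)(k(r-1)-1)+q$. For each $(i,j,h) \in \mathbb{N} \times [k] \times [r-1]$, let \[x_{i,j,h} = (i-1)(k(r-1)-1) + (j-1)(r-1) + h.\] For each $i \in [p]$, let $y_i = n'+i$. For each $(i,j) \in [p]\times[k]$, let $X_{i,j} = \{x_{i,j,h} : h \in [r-1]\}$ and $Y_{i,j} = X_{i,j} \cup \{y_i\}$. Write $q = s(r-1)+t$ with $s \in \{0\}\cup[k]$ and $t \in \{0\} \cup [r-2]$ (where $s<k$ if $t>0$, and $s>0$ if $t=0$). Let $X'_{p,s+1} = [n'-r+2, n']$ and $Y'_{p,s+1} = X'_{p,s+1} \cup \{y_p\}$. Let \[M_{n,r,k} = \{Y_{i,j} : (i,j) \in ([p-1]\times[k]) \cup (\{p\}\times[s])\} \cup \{Y'_{p,s+1}\}.\] If $n > k(r-1)+1$,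 then $U_{n,r,k} = ([n], M_{n,r,k})$. If $n \leq k(r-1)+1$ (so $p=1$ and $y_1=n$), choose a set $S_{n,r,k}$ with $M_{n,r,k} \subseteq S_{n,r,k} \subseteq \{A \in \binom{[n]}{r} : n \in A\}$ and $|S_{n,r,k}| = k$ (possible because $n \geq f(r,k)$; any fixed choice), and let $U_{n,r,k} = ([n], S_{n,r,k})$. *)

theory Defs
  imports Complex_Main
begin

section \<open>Uniform hypergraphs\<close>

type_synonym 'a hgraph = "'a set \<times> 'a set set"

abbreviation verts :: "'a hgraph \<Rightarrow> 'a set" where "verts \<equiv> fst"
abbreviation edges :: "'a hgraph \<Rightarrow> 'a set set" where "edges \<equiv> snd"

definition r_subsets :: "'a set \<Rightarrow> nat \<Rightarrow> 'a set set" where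
  "r_subsets X r = {A. A \<subseteq> X \<and> card A = r}"

text \<open>All graphs are finite; the empty vertex set is allowed.\<close>

definition r_graph :: "nat \<Rightarrow> 'a hgraph \<Rightarrow> bool" where
  "r_graph r G \<longleftrightarrow> finite (verts G) \<and> edges G \<subseteq> r_subsets (verts G) r"

definition indep_set :: "'a hgraph \<Rightarrow> 'a set \<Rightarrow> bool" where
  "indep_set G I \<longleftrightarrow> I \<subseteq> verts G \<and> (\<forall>e \<in> edges G. \<not> e \<subseteq> I)"

definition indep_number :: "'a hgraph \<Rightarrow> nat" where
  "indep_number G = Max {card I | I. indep_set G I}"

definition vdegree :: "'a hgraph \<Rightarrow> 'a \<Rightarrow> nat" where
  "vdegree G v = card {e \<in> edges G. v \<in> e}"

text \<open>Only meaningful for a nonempty vertex set, since \<open>Max {}\<close> is unspecified.\<close>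

definition max_degree :: "'a hgraph \<Rightarrow> nat" where
  "max_degree G = Max (vdegree G ` verts G)"

definition is_path :: "'a hgraph \<Rightarrow> 'a \<Rightarrow> 'a \<Rightarrow> 'a set list \<Rightarrow> bool" where
  "is_path G v w es \<longleftrightarrow>
     es \<noteq> [] \<and> set es \<subseteq> edges G \<and> v \<in> hd es \<and> w \<in> last es \<and>
     (\<forall>i. Suc i < length es \<longrightarrow> es ! i \<inter> es ! Suc i \<noteq> {})"

definition connected_graph :: "'a hgraph \<Rightarrow> bool" where
  "connected_graph G \<longleftrightarrow>
     (\<forall>v \<in> verts G. \<forall>w \<in> verts G. v \<noteq> w \<longrightarrow> (\<exists>es. is_path G v w es))"

definition r_subgraph :: "nat \<Rightarrow> 'a hgraph \<Rightarrow> 'a hgraph \<Rightarrow> bool" where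
  "r_subgraph r H G \<longleftrightarrow> r_graph r H \<and> verts H \<subseteq> verts G \<and> edges H \<subseteq> edges G"

definition is_component :: "nat \<Rightarrow> 'a hgraph \<Rightarrow> 'a hgraph \<Rightarrow> bool" where
  "is_component r H G \<longleftrightarrow>
     r_subgraph r H G \<and> connected_graph H \<and>
     (\<forall>H'. r_subgraph r H' G \<and> connected_graph H' \<and> r_subgraph r H H' \<longrightarrow> H' = H)"

definition nonsingleton_components :: "nat \<Rightarrow> 'a hgraph \<Rightarrow> 'a hgraph set" where
  "nonsingleton_components r G = {H. is_component r H G \<and> card (verts H) \<ge> 2}"

definition is_copy :: "'a hgraph \<Rightarrow> 'b hgraph \<Rightarrow> bool" where
  "is_copy H G \<longleftrightarrow>
     (\<exists>\<phi>. bij_betw \<phi> (verts H) (verts G) \<and> edges G = (\<lambda>e. \<phi> ` e) ` edges H)"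


section \<open>The extremal graphs\<close>

text \<open>Every finite graph has a copy on natural numbers, so quantifying over these is no
  restriction. The graph is required to be nonempty so that its maximum degree is defined.\<close>

definition min_order :: "nat \<Rightarrow> nat \<Rightarrow> nat" where
  "min_order r k = (LEAST n. \<exists>G :: nat hgraph.
     r_graph r G \<and> verts G \<noteq> {} \<and> max_degree G = k \<and> card (verts G) = n)"

text \<open>The definitions below are used with \<open>r \<ge> 2\<close>, \<open>k \<ge> 2\<close> and \<open>n \<ge> min_order r k\<close>;
  then no subtraction on naturals below truncates.\<close>

definition U_p :: "nat \<Rightarrow> nat \<Rightarrow> nat \<Rightarrow> nat" where
  "U_p n r k = nat \<lceil>(real n - 1) / (real k * (real r - 1))\<rceil>"

definition U_q :: "nat \<Rightarrow> nat \<Rightarrow> nat \<Rightarrow> nat" where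
  "U_q n r k = (n - 1) - (U_p n r k - 1) * (k * (r - 1))"

definition U_n' :: "nat \<Rightarrow> nat \<Rightarrow> nat \<Rightarrow> nat" where
  "U_n' n r k = n - U_p n r k"

text \<open>The quotient \<open>s\<close> in \<open>q = s(r - 1) + t\<close> with \<open>0 \<le> t \<le> r - 2\<close>.\<close>

definition U_s :: "nat \<Rightarrow> nat \<Rightarrow> nat \<Rightarrow> nat" where
  "U_s n r k = U_q n r k div (r - 1)"

definition U_x :: "nat \<Rightarrow> nat \<Rightarrow> nat \<Rightarrow> nat \<Rightarrow> nat \<Rightarrow> nat" where
  "U_x r k i j h = (i - 1) * (k * (r - 1) - 1) + (j - 1) * (r - 1) + h"

definition U_y :: "nat \<Rightarrow> nat \<Rightarrow> nat \<Rightarrow> nat \<Rightarrow> nat" where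
  "U_y n r k i = U_n' n r k + i"

definition U_X :: "nat \<Rightarrow> nat \<Rightarrow> nat \<Rightarrow> nat \<Rightarrow> nat set" where
  "U_X r k i j = {U_x r k i j h | h. h \<in> {1..r - 1}}"

definition U_Y :: "nat \<Rightarrow> nat \<Rightarrow> nat \<Rightarrow> nat \<Rightarrow> nat \<Rightarrow> nat set" where
  "U_Y n r k i j = U_X r k i j \<union> {U_y n r k i}"

text \<open>The set \<open>Y'\<^bsub>p,s+1\<^esub>\<close>. The lower bound \<open>n' - r + 2\<close> is written \<open>n' + 2 - r\<close> because \<open>n' = r - 1\<close> can occur.\<close>

definition U_Y' :: "nat \<Rightarrow> nat \<Rightarrow> nat \<Rightarrow> nat set" where
  "U_Y' n r k = {U_n' n r k + 2 - r .. U_n' n r k} \<union> {U_y n r k (U_p n r k)}"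

definition U_M :: "nat \<Rightarrow> nat \<Rightarrow> nat \<Rightarrow> nat set set" where
  "U_M n r k =
     {U_Y n r k i j | i j.
        (i, j) \<in> {1..U_p n r k - 1} \<times> {1..k} \<union> {U_p n r k} \<times> {1..U_s n r k}}
     \<union> {U_Y' n r k}"

text \<open>For small \<open>n\<close> the edge set is an arbitrary fixed choice \<open>S n r k\<close>; the choice function
  \<open>S\<close> is kept as a parameter of \<open>U_graph\<close>, so results are stated for every admissible one.\<close>

definition admissible_choice :: "(nat \<Rightarrow> nat \<Rightarrow> nat \<Rightarrow> nat set set) \<Rightarrow> bool" where
  "admissible_choice S \<longleftrightarrow>
     (\<forall>n r k. r \<ge> 2 \<and> k \<ge> 2 \<and> min_order r k \<le> n \<and> n \<le> k * (r - 1) + 1 \<longrightarrow>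
        U_M n r k \<subseteq> S n r k \<and> S n r k \<subseteq> {A \<in> r_subsets {1..n} r. n \<in> A} \<and>
        card (S n r k) = k)"

text \<open>For \<open>k = 1\<close> only \<open>n = r\<close> is relevant: a connected \<open>r\<close>-graph with at least two
  vertices and maximum degree 1 has exactly \<open>r\<close> vertices.\<close>

definition U_graph ::
  "(nat \<Rightarrow> nat \<Rightarrow> nat \<Rightarrow> nat set set) \<Rightarrow> nat \<Rightarrow> nat \<Rightarrow> nat \<Rightarrow> nat hgraph" where
  "U_graph S n r k =
     (if k = 1 then ({1..r}, {{1..r}})
      else if n > k * (r - 1) + 1 then ({1..n}, U_M n r k)
      else ({1..n}, S n r k))"


section \<open>Admissible choices exist\<close>

lemma min_order_attained:
  assumes "r \<ge> 2" "k \<ge> 1"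
  shows "\<exists>G :: nat hgraph. r_graph r G \<and> verts G \<noteq> {} \<and> max_degree G = k \<and>
           card (verts G) = min_order r k"
proof -
  define e where "e j = insert (r - 1 + j) {..<r - 1}" for j
  define G :: "nat hgraph" where "G = ({..<r - 1 + k}, e ` {..<k})"
  have inj: "inj_on e {..<k}"
    by (auto simp: inj_on_def e_def)
  have rg: "r_graph r G"
    using assms by (auto simp: r_graph_def G_def r_subsets_def e_def)
  have le: "vdegree G v \<le> k" for v
  proof -
    have "vdegree G v \<le> card (e ` {..<k})"
      unfolding vdegree_def G_def by (rule card_mono) auto
    then show ?thesis using inj by (simp add: card_image)
  qed
  have "{d \<in> edges G. 0 \<in> d} = e ` {..<k}"
    using assms by (auto simp: G_def e_def)
  then have "vdegree G 0 = k"
    using inj by (simp add: vdegree_def card_image)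
  moreover have "0 \<in> verts G" "finite (verts G)"
    using assms by (auto simp: G_def)
  ultimately have "max_degree G = k"
    unfolding max_degree_def using le by (intro Max_eqI) auto
  with rg \<open>0 \<in> verts G\<close> have "\<exists>n. \<exists>G :: nat hgraph.
     r_graph r G \<and> verts G \<noteq> {} \<and> max_degree G = k \<and> card (verts G) = n" by blast
  then show ?thesis unfolding min_order_def by (rule LeastI_ex)
qed

lemma card_r_subsets_containing:
  assumes "finite V" "v \<in> V" "r \<ge> 1"
  shows "card {A \<in> r_subsets V r. v \<in> A} = (card V - 1) choose (r - 1)"
proof -
  have "bij_betw (insert v) {A. A \<subseteq> V - {v} \<and> card A = r - 1} {A \<in> r_subsets V r. v \<in> A}"
  proof (rule bij_betw_byWitness[where f' = "\<lambda>A. A - {v}"])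
    show "insert v ` {A. A \<subseteq> V - {v} \<and> card A = r - 1} \<subseteq> {A \<in> r_subsets V r. v \<in> A}"
    proof clarsimp
      fix A assume A: "A \<subseteq> V - {v}" "card A = r - Suc 0"
      then have "finite A" "v \<notin> A" using assms(1) finite_subset by blast+
      then show "insert v A \<in> r_subsets V r" using A assms by (auto simp: r_subsets_def)
    qed
  qed (use assms in \<open>auto simp: r_subsets_def\<close>)
  then have "card {A \<in> r_subsets V r. v \<in> A} = card {A. A \<subseteq> V - {v} \<and> card A = r - 1}"
    by (simp add: bij_betw_same_card)
  then show ?thesis using assms by (simp add: n_subsets)
qed

lemma admissible_choice_pointwise:
  assumes r: "r \<ge> 2" and k: "k \<ge> 2" and lo: "min_order r k \<le> n" and hi: "n \<le> k * (r - 1) + 1"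
  shows "\<exists>T. U_M n r k \<subseteq> T \<and> T \<subseteq> {A \<in> r_subsets {1..n} r. n \<in> A} \<and> card T = k"
proof -
  obtain G :: "nat hgraph" where G: "r_graph r G" "verts G \<noteq> {}" "max_degree G = k"
    "card (verts G) = min_order r k"
    using min_order_attained[of r k] r k by (metis Suc_1 Suc_leD One_nat_def)
  have fin: "finite (verts G)" using G by (simp add: r_graph_def)
  have "max_degree G \<in> vdegree G ` verts G"
    unfolding max_degree_def using fin G by (intro Max_in) auto
  then obtain v where v: "v \<in> verts G" "vdegree G v = k" using G(3) by (metis imageE)
  have finS: "finite (r_subsets X m)" if "finite X" for X :: "nat set" and m
    using that by (auto simp: r_subsets_def)
  have "vdegree G v \<le> card {A \<in> r_subsets (verts G) r. v \<in> A}"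
    unfolding vdegree_def using G(1) finS[OF fin]
    by (intro card_mono) (auto simp: r_graph_def)
  then have "k \<le> card {A \<in> r_subsets (verts G) r. v \<in> A}" using v by simp
  also have "\<dots> = (min_order r k - 1) choose (r - 1)"
    using card_r_subsets_containing[OF fin v(1)] r G by simp
  finally have kc: "k \<le> (min_order r k - 1) choose (r - 1)" .
  also have "\<dots> \<le> (n - 1) choose (r - 1)"
    using lo by (intro binomial_right_mono) auto
  finally have kn: "k \<le> (n - 1) choose (r - 1)" .
  have nr: "n \<ge> r"
    using kn k r by (cases "n - 1 < r - 1") (auto simp: binomial_eq_0)
  define B where "B = {A \<in> r_subsets {1..n} r. n \<in> A}"
  have cB: "k \<le> card B"
    using card_r_subsets_containing[of "{1..n}" n r] kn nr r by (simp add: B_def)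
  have fB: "finite B" by (auto simp: B_def finS)
  have "real n - 1 > 0" using nr r by simp
  moreover have "real n - 1 \<le> real k * (real r - 1)"
  proof -
    have "real n \<le> real (k * (r - 1) + 1)" using hi of_nat_mono by blast
    then show ?thesis using r by (simp add: of_nat_diff)
  qed
  ultimately have "\<lceil>(real n - 1) / (real k * (real r - 1))\<rceil> = 1"
    using k r by (intro ceiling_unique) (auto simp: divide_simps)
  then have p: "U_p n r k = 1" by (simp add: U_p_def)
  have q: "U_q n r k = n - 1" by (simp add: U_q_def p)
  have n': "U_n' n r k = n - 1" by (simp add: U_n'_def p)
  define s where "s = U_s n r k"
  have s: "s = (n - 1) div (r - 1)" by (simp add: s_def U_s_def q)
  have M: "U_M n r k = U_Y n r k 1 ` {1..s} \<union> {U_Y' n r k}"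
    by (auto simp: U_M_def p s_def)
  have Xeq: "U_X r k 1 j = {(j - 1) * (r - 1) + 1 .. j * (r - 1)}" if j1: "j \<ge> 1" for j
  proof -
    obtain m where m: "j = Suc m" using j1 by (cases j) auto
    have "U_X r k 1 j = (\<lambda>h. m * (r - 1) + h) ` {1..r - 1}"
      unfolding U_X_def U_x_def m Setcompr_eq_image by simp
    also have "\<dots> = {m * (r - 1) + 1 .. m * (r - 1) + (r - 1)}"
      by (simp add: image_add_atLeastAtMost)
    finally show ?thesis by (simp add: m add.commute)
  qed
  have sle: "s * (r - 1) \<le> n - 1" by (simp add: s)
  have Y: "U_Y n r k 1 j \<in> B" if j: "j \<in> {1..s}" for j
  proof -
    have j': "j * (r - 1) \<le> n - 1"
      using j sle by (meson atLeastAtMost_iff le_trans mult_le_mono1)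
    have eq: "U_Y n r k 1 j = insert n {(j - 1) * (r - 1) + 1 .. j * (r - 1)}"
      using j nr r Xeq[of j] by (simp add: U_Y_def U_y_def n')
    have "j * (r - 1) - (j - 1) * (r - 1) = r - 1"
      using j by (simp flip: diff_mult_distrib)
    then have "card (U_Y n r k 1 j) = r"
      unfolding eq using j' nr r by (subst card_insert_disjoint) auto
    moreover have "{(j - 1) * (r - 1) + 1 .. j * (r - 1)} \<subseteq> {1..n}"
      using j' by auto
    ultimately show ?thesis unfolding B_def r_subsets_def using eq nr r by auto
  qed
  have eq': "U_Y' n r k = insert n {n + 1 - r .. n - 1}"
    using nr r by (auto simp: U_Y'_def U_y_def n' p)
  have Y': "U_Y' n r k \<in> B"
    unfolding eq' B_def r_subsets_def using nr r by (auto simp: card_insert_if)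
  have MB: "U_M n r k \<subseteq> B" using Y Y' by (auto simp: M)
  have cM: "card (U_M n r k) \<le> k"
  proof (cases "s < k")
    case True
    have "card (U_M n r k) \<le> card (U_Y n r k 1 ` {1..s}) + 1"
      unfolding M by (rule order_trans[OF card_Un_le]) simp
    also have "\<dots> \<le> s + 1"
      using card_image_le[of "{1..s}" "U_Y n r k 1"] by simp
    finally show ?thesis using True by simp
  next
    case False
    have "n - 1 \<le> k * (r - 1)" using hi by simp
    then have "s \<le> k" unfolding s using r by (metis div_le_mono nonzero_mult_div_cancel_right
          Suc_1 diff_is_0_eq not_less_eq_eq)
    with False have sk: "s = k" by simp
    with sle \<open>n - 1 \<le> k * (r - 1)\<close> have nk: "n - 1 = k * (r - 1)" by simp
    have "(k - 1) * (r - 1) + 1 = n + 1 - r"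
    proof -
      obtain m where "k = Suc m" using k by (cases k) auto
      then show ?thesis using nk nr r by simp
    qed
    moreover have "n = Suc (k * (r - 1))" using nk nr r by simp
    ultimately have "U_Y' n r k = U_Y n r k 1 k"
      unfolding eq' U_Y_def U_y_def n' using nk nr r k Xeq[of k] by simp
    then have "U_M n r k = U_Y n r k 1 ` {1..s}" using k by (auto simp: M sk)
    then show ?thesis using card_image_le[of "{1..s}" "U_Y n r k 1"] sk by simp
  qed
  obtain T where "U_M n r k \<subseteq> T" "T \<subseteq> B" "card T = k"
    using exists_subset_between[OF cM cB MB fB] by blast
  then show ?thesis unfolding B_def by blast
qed

lemma admissible_choice_exists: "\<exists>S. admissible_choice S"
proof -
  define S where "S n r k = (SOME T. U_M n r k \<subseteq> T \<and>
    T \<subseteq> {A \<in> r_subsets {1..n} r. n \<in> A} \<and> card T = k)" for n r k :: nat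
  have "admissible_choice S"
    unfolding admissible_choice_def S_def
    using someI_ex[OF admissible_choice_pointwise] by blast
  then show ?thesis by blast
qed

end

theory Submission
  imports Defs
begin

text \<open>
  Complements of independent sets are transversals, that is, vertex sets meeting every edge. The
  claim is therefore that a smallest transversal has at least as many vertices as the sum over the
  non-singleton components \<open>H\<close> of \<open>\<lceil>(\<bar>V(H)\<bar> - 1) / (\<Delta>(H) (r - 1))\<rceil>\<close>, with equality for the given
  graphs. Components are pairwise vertex-disjoint and every edge lies in a non-singleton one, so a
  transversal of \<open>G\<close> restricts to a transversal of each \<open>H\<close>, and transversals of all the \<open>H\<close> unite
  to one of \<open>G\<close>. It remains to look at a single \<open>H\<close>.

  For the bound, two counts are combined. An edge set can be explored from a start vertex so that
  every new edge meets the part already reached and adds at most \<open>r - 1\<close> vertices; hence a connected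
  \<open>H\<close> satisfies \<open>\<bar>V(H)\<bar> - 1 \<le> \<bar>E(H)\<bar> (r - 1)\<close> (\<open>connected_card_verts_le\<close>). A transversal \<open>T\<close> meets
  all edges and each of its vertices lies in at most \<open>\<Delta>(H)\<close> of them, so \<open>\<bar>E(H)\<bar> \<le> \<bar>T\<bar> \<Delta>(H)\<close>
  (\<open>card_edges_le_transversal\<close>).

  For equality with \<open>k \<ge> 2\<close>, the vertices \<open>y\<^sub>1, \<dots>, y\<^sub>p\<close> of \<open>U\<^bsub>n,r,k\<^esub>\<close> form a transversal, because
  every edge was built around one of them, and \<open>p\<close> is exactly the required number; for \<open>k = 1\<close> there
  is a single edge, met by any of its vertices (\<open>U_graph_transversal\<close>). A copy inherits such a
  transversal.
\<close>

section \<open>Transversals and independent sets\<close>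

definition transversal :: "'a hgraph \<Rightarrow> 'a set \<Rightarrow> bool" where
  "transversal G T \<longleftrightarrow> T \<subseteq> verts G \<and> (\<forall>e \<in> edges G. e \<inter> T \<noteq> {})"

lemma r_graph_finite_verts: "r_graph r G \<Longrightarrow> finite (verts G)"
  by (simp add: r_graph_def)

lemma r_graph_edge:
  assumes "r_graph r G" "e \<in> edges G"
  shows "e \<subseteq> verts G" "card e = r"
  using assms by (auto simp: r_graph_def r_subsets_def)

lemma r_graph_finite_edges:
  assumes "r_graph r G"
  shows "finite (edges G)"
proof (rule finite_subset)
  show "edges G \<subseteq> Pow (verts G)" using r_graph_edge(1)[OF assms] by blast
  show "finite (Pow (verts G))" using r_graph_finite_verts[OF assms] by simp
qed

lemma transversal_complement:
  assumes "r_graph r G" "indep_set G I"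
  shows "transversal G (verts G - I)"
  using assms r_graph_edge(1)[OF assms(1)] unfolding transversal_def indep_set_def by blast

lemma indep_set_complement:
  assumes "transversal G T"
  shows "indep_set G (verts G - T)"
  using assms unfolding transversal_def indep_set_def by blast

lemma finite_indep_cards:
  assumes "finite (verts G)"
  shows "finite {card I | I. indep_set G I}"
proof (rule finite_subset)
  show "{card I | I. indep_set G I} \<subseteq> card ` Pow (verts G)"
    by (auto simp: indep_set_def)
qed (use assms in simp)

lemma indep_number_attained:
  assumes "r \<ge> 1" "r_graph r G"
  obtains I where "indep_set G I" "card I = indep_number G"
proof -
  have "indep_set G {}"
    using assms r_graph_edge(2)[OF assms(2)] by (fastforce simp: indep_set_def)
  then have "{card I | I. indep_set G I} \<noteq> {}" by blast
  from Max_in[OF finite_indep_cards[OF r_graph_finite_verts[OF assms(2)]] this]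
  show thesis using that unfolding indep_number_def by auto
qed

lemma indep_number_ge_transversal:
  assumes "finite (verts G)" "transversal G T"
  shows "card (verts G) \<le> indep_number G + card T"
proof -
  have "card (verts G - T) \<le> indep_number G"
    unfolding indep_number_def
    using indep_set_complement[OF assms(2)]
    by (intro Max_ge finite_indep_cards assms(1)) blast
  moreover have "T \<subseteq> verts G" using assms(2) by (simp add: transversal_def)
  ultimately show ?thesis
    using assms(1) by (simp add: card_Diff_subset finite_subset)
qed

lemma card_edges_le_transversal:
  assumes "r_graph r H" "transversal H T"
  shows "card (edges H) \<le> card T * max_degree H"
proof -
  have TV: "T \<subseteq> verts H" using assms(2) by (simp add: transversal_def)
  have finV: "finite (verts H)" and finE: "finite (edges H)"
    using assms(1) by (rule r_graph_finite_verts r_graph_finite_edges)+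
  have finT: "finite T" using TV finV by (rule finite_subset)
  have "edges H \<subseteq> (\<Union>v\<in>T. {e \<in> edges H. v \<in> e})"
    using assms(2) by (fastforce simp: transversal_def)
  then have "card (edges H) \<le> card (\<Union>v\<in>T. {e \<in> edges H. v \<in> e})"
    using finT finE by (intro card_mono) auto
  also have "\<dots> \<le> (\<Sum>v\<in>T. vdegree H v)"
    unfolding vdegree_def by (rule card_UN_le[OF finT])
  also have "\<dots> \<le> (\<Sum>v\<in>T. max_degree H)"
    unfolding max_degree_def using TV finV by (intro sum_mono Max_ge) auto
  finally show ?thesis by simp
qed


section \<open>Paths and connectedness\<close>

lemma is_path_successively:
  "is_path G v w es \<longleftrightarrow> es \<noteq> [] \<and> set es \<subseteq> edges G \<and> v \<in> hd es \<and> w \<in> last es \<and>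
     successively (\<lambda>d e. d \<inter> e \<noteq> {}) es"
  unfolding is_path_def successively_conv_nth by (rule refl)

lemma is_path_append:
  assumes "is_path G u v ds" "is_path G v w es"
  shows "is_path G u w (ds @ es)"
  using assms unfolding is_path_successively by (auto simp: successively_append_iff)

lemma is_path_mono:
  assumes "is_path G v w es" "edges G \<subseteq> edges G'"
  shows "is_path G' v w es"
  using assms by (auto simp: is_path_def)

lemma path_leaving_set:
  assumes "is_path G v w es" "v \<in> W" "w \<notin> W"
  obtains e where "e \<in> edges G" "e \<inter> W \<noteq> {}" "\<not> e \<subseteq> W"
proof -
  have "\<exists>e \<in> set es. e \<inter> W \<noteq> {} \<and> \<not> e \<subseteq> W"
    using assms(1,2)
  proof (induction es arbitrary: v)
    case Nil
    then show ?case by (simp add: is_path_def)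
  next
    case (Cons e es)
    then have v: "v \<in> e" by (simp add: is_path_def)
    show ?case
    proof (cases "e \<subseteq> W")
      case False
      then show ?thesis using v Cons.prems(2) by auto
    next
      case True
      have "es \<noteq> []"
        using True Cons.prems(1) assms(3) by (auto simp: is_path_def)
      then obtain u where "u \<in> e" "is_path G u w es"
        using Cons.prems(1) by (auto simp: is_path_successively successively_Cons)
      then show ?thesis using Cons.IH[of u] True by auto
    qed
  qed
  then show thesis using that assms(1) by (auto simp: is_path_def)
qed

text \<open>A largest edge set \<open>F\<close> that, together with a start vertex \<open>v\<close>, spans at most \<open>1 + \<bar>F\<bar> (r - 1)\<close>
  vertices must span everything: otherwise some path leaves the spanned set through an edge that
  meets it, and adding this edge brings in at most \<open>r - 1\<close> new vertices.\<close>

lemma connected_card_verts_le: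
  assumes r: "r \<ge> 1" and rg: "r_graph r H" and conn: "connected_graph H"
  shows "card (verts H) \<le> 1 + card (edges H) * (r - 1)"
proof (cases "verts H = {}")
  case False
  then obtain v where v: "v \<in> verts H" by blast
  have finE: "finite (edges H)" using rg by (rule r_graph_finite_edges)
  have finV: "finite (verts H)" using rg by (rule r_graph_finite_verts)
  define good where "good F \<longleftrightarrow> F \<subseteq> edges H \<and> card (insert v (\<Union>F)) \<le> 1 + card F * (r - 1)" for F
  have "good {}" by (simp add: good_def)
  moreover have "card F < Suc (card (edges H))" if "good F" for F
    using that card_mono[OF finE] by (auto simp: good_def less_Suc_eq_le)
  ultimately obtain F where F: "good F" and Fmax: "\<And>F'. good F' \<Longrightarrow> card F' \<le> card F"
    using ex_has_greatest_nat[of good "{}" card "Suc (card (edges H))"] by (metis less_imp_le)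
  define W where "W = insert v (\<Union>F)"
  have FE: "F \<subseteq> edges H" and Fcard: "card W \<le> 1 + card F * (r - 1)"
    using F by (auto simp: good_def W_def)
  have finF: "finite F" using FE finE by (rule finite_subset)
  have "W \<subseteq> verts H" using v FE r_graph_edge(1)[OF rg] by (auto simp: W_def)
  then have finW: "finite W" using finV by (rule finite_subset)
  have "verts H \<subseteq> W"
  proof (rule ccontr)
    assume "\<not> verts H \<subseteq> W"
    then obtain w where w: "w \<in> verts H" "w \<notin> W" by blast
    have "v \<in> W" by (simp add: W_def)
    then have "v \<noteq> w" using w(2) by blast
    then obtain es where "is_path H v w es"
      using conn v w(1) unfolding connected_graph_def by blast
    then obtain e where e: "e \<in> edges H" "e \<inter> W \<noteq> {}" "\<not> e \<subseteq> W"
      using \<open>v \<in> W\<close> w(2) by (rule path_leaving_set)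
    have "e \<notin> F" using e(3) by (auto simp: W_def)
    have fine: "finite e" using r_graph_edge(1)[OF rg e(1)] finV finite_subset by blast
    have "card (e \<inter> W) \<ge> 1" using e(2) fine by (simp add: Suc_le_eq card_gt_0_iff)
    moreover have "card (W \<union> e) + card (e \<inter> W) = card W + r"
      using card_Un_Int[OF finW fine] r_graph_edge(2)[OF rg e(1)] by (simp add: Int_commute)
    ultimately have "card (W \<union> e) \<le> card W + (r - 1)" by simp
    also have "\<dots> \<le> 1 + card (insert e F) * (r - 1)"
      using Fcard \<open>e \<notin> F\<close> finF by simp
    also have "W \<union> e = insert v (\<Union>(insert e F))" by (auto simp: W_def)
    finally have "good (insert e F)" using FE e(1) by (simp add: good_def)
    then show False using Fmax \<open>e \<notin> F\<close> finF by fastforce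
  qed
  then have "card (verts H) \<le> card W" using finW by (intro card_mono)
  also have "\<dots> \<le> 1 + card F * (r - 1)" by (rule Fcard)
  also have "\<dots> \<le> 1 + card (edges H) * (r - 1)"
    using card_mono[OF finE FE] by simp
  finally show ?thesis .
qed simp

lemma connected_card_verts_le_transversal:
  assumes "r \<ge> 1" "r_graph r H" "connected_graph H" "transversal H T"
  shows "card (verts H) \<le> 1 + card T * max_degree H * (r - 1)"
  using connected_card_verts_le[OF assms(1-3)] card_edges_le_transversal[OF assms(2,4)]
  by (meson add_left_mono le_trans mult_le_mono1)

text \<open>The whole vertex set is a transversal; with maximum degree 0 the preceding bound would leave
  room for one vertex only.\<close>

lemma connected_max_degree_pos:
  assumes "r \<ge> 1" "r_graph r H" "connected_graph H" "card (verts H) \<ge> 2"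
  shows "max_degree H \<ge> 1"
proof -
  have "e \<inter> verts H \<noteq> {}" if "e \<in> edges H" for e
    using assms(1) r_graph_edge[OF assms(2) that] by (auto simp: Int_absorb2)
  then have "transversal H (verts H)" by (simp add: transversal_def)
  from connected_card_verts_le_transversal[OF assms(1-3) this] assms(4)
  show ?thesis by (cases "max_degree H") auto
qed

lemma connected_transversal_ge_ceiling:
  assumes r: "r \<ge> 2" and H: "r_graph r H" "connected_graph H" "card (verts H) \<ge> 2"
    and T: "transversal H T"
  shows "\<lceil>(real (card (verts H)) - 1) / (real (max_degree H) * (real r - 1))\<rceil> \<le> int (card T)"
proof -
  have "card (verts H) \<le> 1 + card T * max_degree H * (r - 1)"
    using connected_card_verts_le_transversal[OF _ H(1,2) T] r by simp
  then have "real (card (verts H)) \<le> real (1 + card T * max_degree H * (r - 1))"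
    by (rule of_nat_mono)
  then have "real (card (verts H)) - 1 \<le> real (card T) * (real (max_degree H) * (real r - 1))"
    using r by (simp add: of_nat_diff algebra_simps)
  moreover have "real (max_degree H) * (real r - 1) > 0"
    using connected_max_degree_pos[OF _ H] r by simp
  ultimately show ?thesis by (simp add: ceiling_le_iff pos_divide_le_eq)
qed


section \<open>Components\<close>

lemma r_subgraph_trans: "r_subgraph r F H \<Longrightarrow> r_subgraph r H G \<Longrightarrow> r_subgraph r F G"
  by (auto simp: r_subgraph_def)

lemma finite_r_subgraphs:
  assumes "r_graph r G"
  shows "finite {H. r_subgraph r H G}"
proof (rule finite_subset)
  show "{H. r_subgraph r H G} \<subseteq> Pow (verts G) \<times> Pow (edges G)"
    by (auto simp: r_subgraph_def)
qed (use r_graph_finite_verts[OF assms] r_graph_finite_edges[OF assms] in simp)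

lemma component_is_connected:
  assumes "is_component r H G"
  shows "r_graph r H" "r_subgraph r H G" "connected_graph H"
  using assms by (auto simp: is_component_def r_subgraph_def)

lemma finite_nonsingleton_components:
  assumes "r_graph r G"
  shows "finite (nonsingleton_components r G)"
  by (rule finite_subset[OF _ finite_r_subgraphs[OF assms]])
     (auto simp: nonsingleton_components_def is_component_def)

lemma connected_in_component:
  assumes G: "r_graph r G" and F: "r_subgraph r F G" "connected_graph F"
  obtains H where "is_component r H G" "r_subgraph r F H"
proof -
  define \<F> where "\<F> = {H. r_subgraph r H G \<and> connected_graph H \<and> r_subgraph r F H}"
  define size where "size H = card (verts H) + card (edges H)" for H :: "'a hgraph"
  have "finite \<F>"
    by (rule finite_subset[OF _ finite_r_subgraphs[OF G]]) (auto simp: \<F>_def)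
  moreover have "F \<in> \<F>" using F by (auto simp: \<F>_def r_subgraph_def)
  ultimately obtain H where H: "H \<in> \<F>" and Hmax: "\<And>H'. H' \<in> \<F> \<Longrightarrow> size H' \<le> size H"
    using obtains_MAX[of \<F> size] by (metis Max_ge empty_iff finite_imageI imageI)
  have "is_component r H G"
    unfolding is_component_def
  proof (intro conjI allI impI)
    show "r_subgraph r H G" "connected_graph H" using H by (auto simp: \<F>_def)
    fix H' assume H': "r_subgraph r H' G \<and> connected_graph H' \<and> r_subgraph r H H'"
    then have "H' \<in> \<F>" using H r_subgraph_trans unfolding \<F>_def by blast
    then have le: "size H' \<le> size H" by (rule Hmax)
    have sub: "verts H \<subseteq> verts H'" "edges H \<subseteq> edges H'" and "r_graph r H'"
      using H' by (auto simp: r_subgraph_def)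
    then have fin: "finite (verts H')" "finite (edges H')"
      by (auto intro: r_graph_finite_verts r_graph_finite_edges)
    have "card (verts H) \<le> card (verts H')" "card (edges H) \<le> card (edges H')"
      using sub fin by (auto intro: card_mono)
    then have "card (verts H) = card (verts H')" "card (edges H) = card (edges H')"
      using le by (auto simp: size_def)
    then have "verts H = verts H'" "edges H = edges H'"
      using sub fin by (simp_all add: card_subset_eq)
    then show "H' = H" by (simp add: prod_eq_iff)
  qed
  then show thesis using that H by (auto simp: \<F>_def)
qed

text \<open>Two connected graphs with a common vertex have a connected union, so maximality makes two
  components that share a vertex equal to their union.\<close>

lemma connected_Un:
  assumes "connected_graph H" "connected_graph K" "u \<in> verts H" "u \<in> verts K"
  shows "connected_graph (verts H \<union> verts K, edges H \<union> edges K)"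
proof -
  let ?U = "(verts H \<union> verts K, edges H \<union> edges K)"
  have H: "\<exists>es. is_path ?U v w es" if "v \<in> verts H" "w \<in> verts H" "v \<noteq> w" for v w
    using that assms(1) unfolding connected_graph_def by (metis Un_upper1 is_path_mono snd_conv)
  have K: "\<exists>es. is_path ?U v w es" if "v \<in> verts K" "w \<in> verts K" "v \<noteq> w" for v w
    using that assms(2) unfolding connected_graph_def by (metis Un_upper2 is_path_mono snd_conv)
  have "\<exists>es. is_path ?U v w es" if "v \<in> verts ?U" "w \<in> verts ?U" "v \<noteq> w" for v w
  proof (cases "v = u \<or> w = u")
    case True
    then show ?thesis using that assms(3,4) H K by auto
  next
    case False
    then have "\<exists>es. is_path ?U v u es" "\<exists>es. is_path ?U u w es"
      using that(1,2) assms(3,4) H K by auto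
    then obtain ds es where "is_path ?U v u ds" "is_path ?U u w es" by blast
    then have "is_path ?U v w (ds @ es)" by (rule is_path_append)
    then show ?thesis by blast
  qed
  then show ?thesis unfolding connected_graph_def by blast
qed

lemma components_disjoint:
  assumes "is_component r H G" "is_component r K G" "H \<noteq> K"
  shows "verts H \<inter> verts K = {}"
proof (rule ccontr)
  assume "verts H \<inter> verts K \<noteq> {}"
  then obtain u where u: "u \<in> verts H" "u \<in> verts K" by blast
  let ?U = "(verts H \<union> verts K, edges H \<union> edges K)"
  have "connected_graph ?U"
    using assms(1,2) u by (intro connected_Un) (auto dest: component_is_connected)
  moreover have "r_subgraph r ?U G" "r_subgraph r H ?U" "r_subgraph r K ?U"
    using component_is_connected[OF assms(1)] component_is_connected[OF assms(2)]
    by (auto simp: r_subgraph_def r_graph_def r_subsets_def)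
  ultimately have "?U = H" "?U = K"
    using assms(1,2) unfolding is_component_def by blast+
  then show False using assms(3) by simp
qed

lemma edge_in_nonsingleton_component:
  assumes r: "r \<ge> 2" and G: "r_graph r G" and e: "e \<in> edges G"
  obtains H where "H \<in> nonsingleton_components r G" "e \<in> edges H"
proof -
  have e': "e \<subseteq> verts G" "card e = r" using r_graph_edge[OF G e] .
  have "finite e" using e'(1) r_graph_finite_verts[OF G] by (rule finite_subset)
  then have "r_subgraph r (e, {e}) G"
    using e e' by (auto simp: r_subgraph_def r_graph_def r_subsets_def)
  moreover have "connected_graph (e, {e})"
    unfolding connected_graph_def by (auto simp: is_path_def intro!: exI[of _ "[e]"])
  ultimately obtain H where H: "is_component r H G" "r_subgraph r (e, {e}) H"
    using connected_in_component[OF G] by blast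
  then have "e \<subseteq> verts H" "e \<in> edges H" by (auto simp: r_subgraph_def)
  moreover have "card e \<le> card (verts H)"
    using \<open>e \<subseteq> verts H\<close> r_graph_finite_verts[OF component_is_connected(1)[OF H(1)]]
    by (intro card_mono)
  ultimately show thesis using that[of H] H(1) r e'(2) by (simp add: nonsingleton_components_def)
qed


section \<open>The extremal graphs have small transversals\<close>

lemma min_order_le_card:
  fixes H :: "'a hgraph"
  assumes H: "r_graph r H" and ne: "verts H \<noteq> {}"
  shows "min_order r (max_degree H) \<le> card (verts H)"
proof -
  have finV: "finite (verts H)" using H by (rule r_graph_finite_verts)
  \<comment> \<open>The minimum ranges over graphs on natural numbers, so \<open>H\<close> is first copied there.\<close>
  obtain f :: "'a \<Rightarrow> nat" where f: "inj_on f (verts H)"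
    using finite_imp_inj_to_nat_seg[OF finV] by blast
  define K :: "nat hgraph" where "K = (f ` verts H, image f ` edges H)"
  have sub: "e \<subseteq> verts H" if "e \<in> edges H" for e using r_graph_edge(1)[OF H that] .
  have "r_graph r K"
    using finV sub r_graph_edge(2)[OF H] inj_on_subset[OF f]
    by (auto simp: r_graph_def r_subsets_def K_def card_image)
  moreover have deg: "vdegree K (f v) = vdegree H v" if v: "v \<in> verts H" for v
  proof -
    have "f v \<in> f ` e \<longleftrightarrow> v \<in> e" if "e \<in> edges H" for e
      using inj_on_image_mem_iff[OF f v sub[OF that]] .
    then have "{d \<in> edges K. f v \<in> d} = image f ` {e \<in> edges H. v \<in> e}"
      unfolding K_def snd_conv by blast
    moreover have "inj_on (image f) {e \<in> edges H. v \<in> e}"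
      using sub inj_on_image_eq_iff[OF f] by (auto intro!: inj_onI)
    ultimately show ?thesis by (simp add: vdegree_def card_image)
  qed
  have "vdegree K ` verts K = vdegree H ` verts H"
    using deg by (force simp: K_def)
  then have "max_degree K = max_degree H" by (simp add: max_degree_def)
  moreover have "verts K \<noteq> {}" "card (verts K) = card (verts H)"
    using ne f by (auto simp: K_def card_image)
  ultimately show ?thesis unfolding min_order_def by (intro Least_le) blast
qed

lemma ceiling_eq_U_p:
  assumes "n \<ge> 1" "r \<ge> 1"
  shows "\<lceil>(real n - 1) / (real k * (real r - 1))\<rceil> = int (U_p n r k)"
proof -
  have "(real n - 1) / (real k * (real r - 1)) \<ge> 0" using assms by simp
  then show ?thesis unfolding U_p_def by (simp add: le_ceiling_iff)
qed

text \<open>The upper bound ensures that \<open>y\<^sub>i = n - p + i\<close>, whose subtraction is on naturals, is at most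
  \<open>n\<close> for \<open>i \<le> p\<close>.\<close>

lemma U_p_bounds:
  assumes n: "n \<ge> 2" and r: "r \<ge> 2" and k: "k \<ge> 1"
  shows "1 \<le> U_p n r k" "U_p n r k \<le> n"
proof -
  have d: "real k * (real r - 1) \<ge> 1 * 1" using r k by (intro mult_mono) auto
  have "(real n - 1) / (real k * (real r - 1)) > 0" using n d by simp
  moreover have "(real n - 1) / (real k * (real r - 1)) \<le> real n"
  proof -
    have "(real n - 1) / (real k * (real r - 1)) \<le> (real n - 1) / 1"
      using n d by (intro divide_left_mono) auto
    then show ?thesis by simp
  qed
  ultimately show "1 \<le> U_p n r k" "U_p n r k \<le> n"
    unfolding U_p_def by (simp_all add: Suc_le_eq zero_less_ceiling ceiling_le_iff)
qed

text \<open>For \<open>k \<ge> 2\<close> and \<open>n > k (r - 1) + 1\<close> the vertices \<open>y\<^sub>1, \<dots>, y\<^sub>p\<close> meet all edges. For smaller \<open>n\<close> the only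
  such vertex is \<open>y\<^sub>1 = n\<close>, which lies in every edge of an admissible choice.\<close>

lemma U_graph_transversal:
  assumes S: "admissible_choice S" and r: "r \<ge> 2" and k: "k \<ge> 1" and n: "n \<ge> 2"
    and lo: "min_order r k \<le> n"
  obtains T where "transversal (U_graph S n r k) T" "card T \<le> U_p n r k"
proof -
  note p = U_p_bounds[OF n r k]
  consider "k = 1" | "k \<ge> 2" "n \<le> k * (r - 1) + 1" | "k \<ge> 2" "n > k * (r - 1) + 1"
    using k by linarith
  then show thesis
  proof cases
    case 1
    then show thesis using that[of "{1}"] p(1) r by (auto simp: U_graph_def transversal_def)
  next
    case 2
    then have "S n r k \<subseteq> {A \<in> r_subsets {1..n} r. n \<in> A}"
      using S r lo unfolding admissible_choice_def by blast
    then show thesis using that[of "{n}"] p(1) 2 n by (auto simp: U_graph_def transversal_def)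
  next
    case 3
    let ?T = "U_y n r k ` {1..U_p n r k}"
    have "?T \<subseteq> {1..n}" using p by (auto simp: U_y_def U_n'_def)
    moreover have "e \<inter> ?T \<noteq> {}" if "e \<in> U_M n r k" for e
      using that p by (force simp: U_M_def U_Y_def U_Y'_def)
    ultimately have "transversal (U_graph S n r k) ?T"
      using 3 by (auto simp: U_graph_def transversal_def)
    moreover have "card ?T \<le> U_p n r k" using card_image_le[of "{1..U_p n r k}"] by simp
    ultimately show thesis by (rule that)
  qed
qed

lemma transversal_copy:
  assumes "is_copy H K" and rg: "r_graph r H" and T: "transversal K T"
  obtains T' where "transversal H T'" "card T' = card T"
proof -
  obtain \<phi> where \<phi>: "bij_betw \<phi> (verts H) (verts K)" and E: "edges K = (`) \<phi> ` edges H"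
    using assms(1) by (auto simp: is_copy_def)
  define T' where "T' = {v \<in> verts H. \<phi> v \<in> T}"
  have "transversal H T'"
    unfolding transversal_def
  proof (intro conjI ballI)
    fix e assume e: "e \<in> edges H"
    then have "\<phi> ` e \<inter> T \<noteq> {}" using T E by (auto simp: transversal_def)
    then show "e \<inter> T' \<noteq> {}" using r_graph_edge(1)[OF rg e] by (auto simp: T'_def)
  qed (auto simp: T'_def)
  moreover have "bij_betw \<phi> T' T"
    unfolding bij_betw_def
  proof
    show "inj_on \<phi> T'" using \<phi> by (auto simp: bij_betw_def T'_def inj_on_def)
    show "\<phi> ` T' = T" using \<phi> T by (auto simp: bij_betw_def T'_def transversal_def)
  qed
  ultimately show thesis using that bij_betw_same_card by blast
qed


section \<open>Combining the components\<close>

lemma sum_components_le_transversal: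
  assumes r: "r \<ge> 2" and G: "r_graph r G" and T: "transversal G T"
  shows "(\<Sum>H \<in> nonsingleton_components r G.
           \<lceil>(real (card (verts H)) - 1) / (real (max_degree H) * (real r - 1))\<rceil>) \<le> int (card T)"
proof -
  let ?C = "nonsingleton_components r G"
  have finT: "finite T"
    using T r_graph_finite_verts[OF G] finite_subset by (auto simp: transversal_def)
  have "(\<Sum>H \<in> ?C. \<lceil>(real (card (verts H)) - 1) / (real (max_degree H) * (real r - 1))\<rceil>)
      \<le> (\<Sum>H \<in> ?C. int (card (T \<inter> verts H)))"
  proof (rule sum_mono)
    fix H assume "H \<in> ?C"
    then have H: "is_component r H G" "card (verts H) \<ge> 2"
      by (auto simp: nonsingleton_components_def)
    note H' = component_is_connected[OF H(1)]
    have "e \<inter> (T \<inter> verts H) \<noteq> {}" if "e \<in> edges H" for e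
    proof -
      have "e \<inter> T \<noteq> {}" using T H'(2) that by (auto simp: transversal_def r_subgraph_def)
      then show ?thesis using r_graph_edge(1)[OF H'(1) that] by blast
    qed
    then have "transversal H (T \<inter> verts H)" by (simp add: transversal_def)
    then show "\<lceil>(real (card (verts H)) - 1) / (real (max_degree H) * (real r - 1))\<rceil>
        \<le> int (card (T \<inter> verts H))"
      using r H' H(2) by (intro connected_transversal_ge_ceiling)
  qed
  also have "\<dots> = int (card (\<Union>H \<in> ?C. T \<inter> verts H))"
  proof -
    have "card (\<Union>H \<in> ?C. T \<inter> verts H) = (\<Sum>H \<in> ?C. card (T \<inter> verts H))"
    proof (rule card_UN_disjoint)
      show "\<forall>H \<in> ?C. \<forall>K \<in> ?C. H \<noteq> K \<longrightarrow> (T \<inter> verts H) \<inter> (T \<inter> verts K) = {}"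
        unfolding nonsingleton_components_def using components_disjoint by blast
    qed (use finT finite_nonsingleton_components[OF G] in auto)
    then show ?thesis by simp
  qed
  also have "\<dots> \<le> int (card T)"
    using finT by (intro of_nat_mono card_mono) auto
  finally show ?thesis .
qed

lemma transversal_UN_components:
  assumes r: "r \<ge> 2" and G: "r_graph r G"
    and T: "\<And>H. H \<in> nonsingleton_components r G \<Longrightarrow> transversal H (T H)"
  shows "transversal G (\<Union>H \<in> nonsingleton_components r G. T H)"
  unfolding transversal_def
proof (intro conjI ballI)
  have "T H \<subseteq> verts G" if "H \<in> nonsingleton_components r G" for H
    using T[OF that] that component_is_connected(2)[of r H G]
    by (auto simp: transversal_def nonsingleton_components_def r_subgraph_def)
  then show "(\<Union>H \<in> nonsingleton_components r G. T H) \<subseteq> verts G" by blast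
  fix e assume "e \<in> edges G"
  then obtain H where "H \<in> nonsingleton_components r G" "e \<in> edges H"
    using edge_in_nonsingleton_component[OF r G] by blast
  then show "e \<inter> (\<Union>H \<in> nonsingleton_components r G. T H) \<noteq> {}"
    using T[of H] by (auto simp: transversal_def)
qed

lemma extremal_component_transversal:
  assumes r: "r \<ge> 2" and S: "admissible_choice S" and H: "H \<in> nonsingleton_components r G"
    and copy: "is_copy H (U_graph S (card (verts H)) r (max_degree H))"
  obtains T where "transversal H T"
    "int (card T) \<le> \<lceil>(real (card (verts H)) - 1) / (real (max_degree H) * (real r - 1))\<rceil>"
proof -
  have comp: "is_component r H G" and n: "card (verts H) \<ge> 2"
    using H by (auto simp: nonsingleton_components_def)
  note H' = component_is_connected[OF comp]
  have k: "max_degree H \<ge> 1" using connected_max_degree_pos[OF _ H'(1,3) n] r by simp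
  have "min_order r (max_degree H) \<le> card (verts H)"
    using H'(1) n by (intro min_order_le_card) auto
  then obtain T where "transversal (U_graph S (card (verts H)) r (max_degree H)) T"
    "card T \<le> U_p (card (verts H)) r (max_degree H)"
    using U_graph_transversal[OF S r k n] by blast
  moreover from this(1) obtain T' where "transversal H T'" "card T' = card T"
    using transversal_copy[OF copy H'(1)] by blast
  ultimately show thesis using that ceiling_eq_U_p n r by simp
qed

theorem corollary2p3:
  fixes r :: nat and G :: "'a hgraph"
  assumes "r \<ge> 2" and "r_graph r G"
  shows "int (indep_number G) \<le> int (card (verts G)) -
           (\<Sum>H \<in> nonsingleton_components r G.
              \<lceil>(real (card (verts H)) - 1) / (real (max_degree H) * (real r - 1))\<rceil>)
       \<and> (\<forall>S. admissible_choice S \<longrightarrow>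
           (\<forall>H \<in> nonsingleton_components r G.
              is_copy H (U_graph S (card (verts H)) r (max_degree H))) \<longrightarrow>
           int (indep_number G) = int (card (verts G)) -
           (\<Sum>H \<in> nonsingleton_components r G.
              \<lceil>(real (card (verts H)) - 1) / (real (max_degree H) * (real r - 1))\<rceil>))"
proof (intro conjI allI impI)
  let ?C = "nonsingleton_components r G"
  let ?b = "\<lambda>H :: 'a hgraph. \<lceil>(real (card (verts H)) - 1) / (real (max_degree H) * (real r - 1))\<rceil>"
  have finV: "finite (verts G)" using assms(2) by (rule r_graph_finite_verts)
  show upper: "int (indep_number G) \<le> int (card (verts G)) - (\<Sum>H \<in> ?C. ?b H)"
  proof -
    obtain I where I: "indep_set G I" "card I = indep_number G"
      using indep_number_attained[OF _ assms(2)] assms(1) by auto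
    then have "I \<subseteq> verts G" by (simp add: indep_set_def)
    then have "int (card (verts G - I)) = int (card (verts G)) - int (indep_number G)"
      using finV I(2) card_mono[of "verts G" I]
      by (simp add: card_Diff_subset finite_subset of_nat_diff)
    then show ?thesis
      using sum_components_le_transversal[OF assms transversal_complement[OF assms(2) I(1)]]
      by simp
  qed
  fix S :: "nat \<Rightarrow> nat \<Rightarrow> nat \<Rightarrow> nat set set"
  assume S: "admissible_choice S"
    and copies: "\<forall>H \<in> ?C. is_copy H (U_graph S (card (verts H)) r (max_degree H))"
  have "\<forall>H \<in> ?C. \<exists>T. transversal H T \<and> int (card T) \<le> ?b H"
  proof
    fix H assume H: "H \<in> ?C"
    with copies have "is_copy H (U_graph S (card (verts H)) r (max_degree H))" by (rule bspec)
    from extremal_component_transversal[OF assms(1) S H this]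
    show "\<exists>T. transversal H T \<and> int (card T) \<le> ?b H" by blast
  qed
  from bchoice[OF this] obtain T where
    "\<forall>H \<in> ?C. transversal H (T H) \<and> int (card (T H)) \<le> ?b H" by blast
  then have T: "\<And>H. H \<in> ?C \<Longrightarrow> transversal H (T H)"
    and Tcard: "\<And>H. H \<in> ?C \<Longrightarrow> int (card (T H)) \<le> ?b H"
    by blast+
  have "card (verts G) \<le> indep_number G + card (\<Union>H \<in> ?C. T H)"
    using finV transversal_UN_components[OF assms T] by (rule indep_number_ge_transversal)
  moreover have "int (card (\<Union>H \<in> ?C. T H)) \<le> (\<Sum>H \<in> ?C. ?b H)"
  proof -
    have "int (card (\<Union>H \<in> ?C. T H)) \<le> int (\<Sum>H \<in> ?C. card (T H))"
      using card_UN_le[OF finite_nonsingleton_components[OF assms(2)]] by (rule of_nat_mono)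
    also have "\<dots> \<le> (\<Sum>H \<in> ?C. ?b H)"
      using Tcard by (simp add: sum_mono)
    finally show ?thesis .
  qed
  ultimately show "int (indep_number G) = int (card (verts G)) - (\<Sum>H \<in> ?C. ?b H)"
    using upper by linarith
qed

end
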